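(* Let $G$ be a connected graph of order $n$ and let $v_1,\dots,v_n$ be a linear order of its vertices with back-degrees $d_1,\dots,d_n$. Let $F$ be the number of faces of a uniformly random orientable 2-cell embedding of $G$. Then $$\mathbb{E}[F]\le 1+\sum_{i=3}^n \log d_i^*,$$ where $d_i^*=d_i$ if $d_i\ne 2$ and $d_i^*=e$ if $d_i=2$. Moreover, $$\mathbb{E}[F]\le 1+\sum_{i=3}^n H_{d_i-1}.$$
   Context: The back-degree $d_i$ of $v_i$ is the number of neighbors $v_j$ of $v_i$ with $j<i$, except that if this number is $0$ then $d_i$ is defined to be $1$. Orientable 2-cell embeddings are identified with rotation systems (a cyclic permutation of the darts at each vertex). A uniformly random embedding chooses these independently and uniformly. The faces are the orbits of the face permutation $\sigma\cdot\prod_v\pi_v$, where $\sigma$ is the involution exchanging the two darts of each edge. $\log$ is the natural logarithm, and $H_m=1+\tfrac12+\cdots+\tfrac1m$ with $H_0=0$. *)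

theory Defs
  imports
    "HOL-Probability.Probability"
    "HOL-Combinatorics.Orbits"
    "Graph_Theory.Digraph_Component"
begin

text \<open>
  A finite simple graph is a \<^locale>\<open>pair_graph\<close>: a finite loopless digraph whose arc set is
  symmetric.  Thus every edge \<open>uv\<close> is a pair of opposite arcs; these are its two darts, the dart
  \<open>(u, v)\<close> being the one at \<open>u\<close>.
\<close>

text \<open>
  The cyclic permutations of the darts at \<open>v\<close>.  A vertex without darts, which in a connected graph
  only occurs for the one-vertex graph, has the identity as its only rotation.
\<close>
definition rotations :: "'a pair_pre_digraph \<Rightarrow> 'a \<Rightarrow> ('a \<times> 'a \<Rightarrow> 'a \<times> 'a) set" where
  "rotations G v =
     {p. p permutes out_arcs (with_proj G) v \<and>
         (out_arcs (with_proj G) v \<noteq> {} \<longrightarrow> cyclic_on p (out_arcs (with_proj G) v))}"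

definition random_embedding ::
  "'a pair_pre_digraph \<Rightarrow> ('a \<Rightarrow> 'a \<times> 'a \<Rightarrow> 'a \<times> 'a) pmf" where
  "random_embedding G = Pi_pmf (pverts G) id (\<lambda>v. pmf_of_set (rotations G v))"

text \<open>
  The local rotations have pairwise disjoint supports, so they commute and their product maps every
  dart \<open>d\<close> to its image under the rotation at its tail \<open>fst d\<close>.  The order in which this product
  is composed with the dart involution does not affect the number of faces, because the two
  composites are conjugate.
\<close>
definition face_perm ::
  "'a pair_pre_digraph \<Rightarrow> ('a \<Rightarrow> 'a \<times> 'a \<Rightarrow> 'a \<times> 'a) \<Rightarrow> 'a \<times> 'a \<Rightarrow> 'a \<times> 'a" where
  "face_perm G \<pi> = swap_in (parcs G) \<circ> (\<lambda>d. \<pi> (fst d) d)"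

definition faces ::
  "'a pair_pre_digraph \<Rightarrow> ('a \<Rightarrow> 'a \<times> 'a \<Rightarrow> 'a \<times> 'a) \<Rightarrow> ('a \<times> 'a) set set" where
  "faces G \<pi> = orbit (face_perm G \<pi>) ` parcs G"

definition expected_faces :: "'a pair_pre_digraph \<Rightarrow> real" where
  "expected_faces G =
     measure_pmf.expectation (random_embedding G) (\<lambda>\<pi>. real (card (faces G \<pi>)))"

definition back_degree :: "'a pair_pre_digraph \<Rightarrow> (nat \<Rightarrow> 'a) \<Rightarrow> nat \<Rightarrow> nat" where
  "back_degree G v i =
     (let k = card {w \<in> v ` {1..<i}. (v i, w) \<in> parcs G} in if k = 0 then 1 else k)"

definition adjusted_back_degree :: "'a pair_pre_digraph \<Rightarrow> (nat \<Rightarrow> 'a) \<Rightarrow> nat \<Rightarrow> real" where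
  "adjusted_back_degree G v i =
     (if back_degree G v i = 2 then exp 1 else real (back_degree G v i))"

end

theory Submission
  imports Defs
begin

text \<open>
  Switch on the rotations vertex by vertex, starting from the embedding in which every rotation is
  the identity; the darts of a vertex not yet processed then behave like pendant edges.  If \<open>\<rho>\<close> is
  the current face permutation and \<open>\<pi>\<close> the uniformly random rotation at the next vertex \<open>v\<close>, then the
  orbits of \<open>\<rho>\<close> that avoid the darts at \<open>v\<close> survive in \<open>\<rho> \<circ> \<pi>\<close>, and the expected number of the
  other orbits of \<open>\<rho> \<circ> \<pi>\<close> is at most \<open>1 + log d\<close>, with \<open>1 + 1\<close> for \<open>d = 2\<close>, where only the \<open>d\<close>
  darts leading back matter because the others are alone in their orbit among the darts at \<open>v\<close>.
  At least one orbit of \<open>\<rho>\<close> at \<open>v\<close> is lost per component merged at \<open>v\<close>, so the expectation of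
  (orbits minus components) grows by at most \<open>log d\<close>.

  The bound for a fixed permutation \<open>\<sigma>\<close> composed with a random cyclic permutation \<open>\<pi>\<close> of \<open>m\<close> points
  is proved by revealing the image \<open>y = \<pi> x\<close> of one point, which leaves the same problem on \<open>m - 1\<close>
  points.  A cycle closes for at most one of the \<open>m - 1\<close> values of \<open>y\<close>, and \<open>y = \<sigma> x\<close> creates a new
  fixed point; fixed points do not count, and this gain turns the harmonic sum into a logarithm.
\<close>

subsection \<open>Orbits after deleting a point\<close>

text \<open>This is \<open>rotations\<close> detached from the graph, so that points can be removed
  from the set. For the empty set the guard leaves exactly \<open>id\<close>.\<close>

definition cycle_perms :: "'a set \<Rightarrow> ('a \<Rightarrow> 'a) set" where
  "cycle_perms S = {p. p permutes S \<and> (S \<noteq> {} \<longrightarrow> cyclic_on p S)}"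

text \<open>Cuts \<open>y\<close> out of its cycle: the predecessor of \<open>y\<close> is sent on
  to \<open>f y\<close>, and \<open>y\<close> becomes a fixed point.\<close>

definition skip :: "'a \<Rightarrow> ('a \<Rightarrow> 'a) \<Rightarrow> 'a \<Rightarrow> 'a" where
  "skip y f = Transposition.transpose y (f y) \<circ> f"

lemma skip_apply:
  assumes "inj f"
  shows "skip y f z = (if z = y then y else if f z = y then f y else f z)"
  by (simp add: skip_def Transposition.transpose_def inj_eq[OF assms])

lemma skip_permutes:
  assumes "f permutes S" "y \<in> S"
  shows "skip y f permutes (S - {y})"
proof -
  have "skip y f permutes S"
    unfolding skip_def using assms
    by (intro permutes_compose permutes_swap_id) (auto simp: permutes_in_image)
  moreover have "skip y f y = y"
    by (simp add: skip_def)
  ultimately show ?thesis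
    by (auto simp: permutes_def)
qed

lemma skip_comp: "p y = y \<Longrightarrow> skip y (f \<circ> p) = skip y f \<circ> p"
  by (simp add: skip_def comp_assoc)

lemma orbit_refl:
  assumes "f permutes S" "finite S"
  shows "z \<in> orbit f z"
  using assms by (intro permutation_self_in_orbit) (auto simp: permutation_permutes)

lemma orbit_eqI_mem:
  assumes "f permutes S" "finite S" "w \<in> orbit f z"
  shows "orbit f w = orbit f z"
  using cyclic_on_orbit[OF assms(1,2)] assms(3) by (rule orbit_cyclic_eq3)

lemma orbit_skip:
  assumes "f permutes S" "finite S" "z \<noteq> y"
  shows "orbit (skip y f) z = orbit f z - {y}"
proof (cases "f y = y")
  case True
  then have "skip y f = f"
    by (simp add: skip_def)
  moreover have "y \<notin> orbit f z"
  proof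
    assume "y \<in> orbit f z"
    then have "orbit f z = {y}"
      using True orbit_eqI_mem[OF assms(1,2), of y z] orbit_eq_singleton_iff[of f y] by simp
    then show False
      using orbit_refl[OF assms(1,2), of z] assms(3) by auto
  qed
  ultimately show ?thesis
    by simp
next
  case False
  have sk: "skip y f w = (if w = y then y else if f w = y then f y else f w)" for w
    using skip_apply permutes_inj[OF assms(1)] by metis
  show ?thesis
  proof (intro equalityI subsetI)
    fix w assume "w \<in> orbit (skip y f) z"
    then show "w \<in> orbit f z - {y}"
    proof induction
      case base
      show ?case
        using assms(3) False orbit.base[of f z] orbit.step[OF orbit.base[of f z]]
        by (auto simp: sk[of z])
    next
      case (step w)
      then have "f w \<in> orbit f z" "f (f w) \<in> orbit f z"
        by (simp_all add: orbit.step)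
      then show ?case
        using False step by (auto simp: sk[of w])
    qed
  next
    fix w assume "w \<in> orbit f z - {y}"
    then have "w \<in> orbit f z" "w \<noteq> y" by auto
    \<comment> \<open>The invariant is strengthened at \<open>y\<close>: while the walk of
      \<open>f\<close> stands there, the walk of \<open>skip y f\<close> has already arrived at
      \<open>f y\<close>.\<close>
    have "(w \<noteq> y \<longrightarrow> w \<in> orbit (skip y f) z) \<and> (w = y \<longrightarrow> f y \<in> orbit (skip y f) z)"
      using \<open>w \<in> orbit f z\<close>
    proof induction
      case base
      then show ?case
        using assms(3) orbit.base[of "skip y f" z] by (auto simp: sk[of z] split: if_splits)
    next
      case (step w)
      then show ?case
        using False orbit.step[of w "skip y f" z] by (cases "w = y") (auto simp: sk[of w] split: if_splits)
    qed
    then show "w \<in> orbit (skip y f) z"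
      using \<open>w \<noteq> y\<close> by blast
  qed
qed

text \<open>Removing \<open>y\<close> only trims its cycle, and trimmed cycles stay distinct. A
  cycle vanishes precisely when it was \<open>{y}\<close>.\<close>

lemma card_orbits_skip:
  assumes "f permutes S" "finite S" "y \<in> S"
  shows "card (orbit f ` S) = card (orbit (skip y f) ` (S - {y})) + of_bool (f y = y)"
proof -
  have img: "orbit (skip y f) ` (S - {y}) = (\<lambda>C. C - {y}) ` (orbit f ` (S - {y}))"
    unfolding image_image by (intro image_cong refl) (simp add: orbit_skip[OF assms(1,2)])
  have "inj_on (\<lambda>C. C - {y}) (orbit f ` (S - {y}))"
  proof (rule inj_onI)
    fix C C' assume C: "C \<in> orbit f ` (S - {y})" "C' \<in> orbit f ` (S - {y})" "C - {y} = C' - {y}"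
    then obtain z z' where z: "C = orbit f z" "z \<noteq> y" "C' = orbit f z'" by auto
    then have "z \<in> C'"
      using C(3) orbit_refl[OF assms(1,2), of z] by blast
    then show "C = C'"
      using z orbit_eqI_mem[OF assms(1,2), of z z'] by simp
  qed
  then have card: "card (orbit (skip y f) ` (S - {y})) = card (orbit f ` (S - {y}))"
    by (simp add: img card_image)
  have S: "orbit f ` S = insert (orbit f y) (orbit f ` (S - {y}))"
    using assms(3) by blast
  show ?thesis
  proof (cases "f y = y")
    case True
    then have "orbit f y = {y}"
      by (simp add: orbit_eq_singleton_iff)
    moreover have "{y} \<notin> orbit f ` (S - {y})"
      using orbit_refl[OF assms(1,2)] by force
    ultimately show ?thesis
      unfolding S card using True assms(2) by simp
  next
    case False
    moreover have "orbit f y = orbit f (f y)"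
      using orbit_eqI_mem[OF assms(1,2) orbit.base] by (rule sym)
    moreover have "f y \<in> S"
      using assms by (simp add: permutes_in_image)
    ultimately have "orbit f y \<in> orbit f ` (S - {y})"
      by blast
    then show ?thesis
      unfolding S card using False by (simp add: insert_absorb)
  qed
qed

lemma orbit_comp_commute: "orbit (g \<circ> h) (g x) = g ` orbit (h \<circ> g) x"
proof (intro equalityI subsetI)
  fix w assume "w \<in> orbit (g \<circ> h) (g x)"
  then show "w \<in> g ` orbit (h \<circ> g) x"
  proof induction
    case base
    show ?case
      by (rule image_eqI[OF _ orbit.base]) simp
  next
    case (step w)
    then obtain u where u: "u \<in> orbit (h \<circ> g) x" "w = g u" by blast
    show ?case
      by (rule image_eqI[OF _ orbit.step[OF u(1)]]) (simp add: u(2))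
  qed
next
  have "g w \<in> orbit (g \<circ> h) (g x)" if "w \<in> orbit (h \<circ> g) x" for w
    using that
  proof induction
    case base
    show ?case
      using orbit.base[of "g \<circ> h" "g x"] by (simp add: comp_def)
  next
    case (step w)
    then show ?case
      using orbit.step[of "g w" "g \<circ> h" "g x"] by (simp add: comp_def)
  qed
  then show "w \<in> orbit (g \<circ> h) (g x)" if "w \<in> g ` orbit (h \<circ> g) x" for w
    using that by auto
qed

text \<open>The map \<open>g\<close> carries the cycles of \<open>h \<circ> g\<close> to those of
  \<open>g \<circ> h\<close>. This later moves a transposition from the random factor over to the
  fixed one.\<close>

lemma card_orbits_comp_commute:
  assumes "g permutes S"
  shows "card (orbit (g \<circ> h) ` S) = card (orbit (h \<circ> g) ` S)"
proof -
  have "orbit (g \<circ> h) ` S = orbit (g \<circ> h) ` (g ` S)"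
    using assms by (simp add: permutes_image)
  also have "\<dots> = image g ` (orbit (h \<circ> g) ` S)"
    by (simp add: image_image orbit_comp_commute)
  also have "card \<dots> = card (orbit (h \<circ> g) ` S)"
    using inj_image_eq_iff[OF permutes_inj[OF assms]] by (intro card_image inj_onI) blast
  finally show ?thesis .
qed

subsection \<open>Composition with a random cyclic permutation\<close>

lemma finite_cycle_perms: "finite S \<Longrightarrow> finite (cycle_perms S)"
  by (rule finite_subset[OF _ finite_permutations]) (auto simp: cycle_perms_def)

lemma cycle_perms_singleton: "cycle_perms {x} = {id}"
proof -
  have "cyclic_on id {x}"
    by (metis cyclic_on_singleI id_apply insertI1 orbit_eq_singleton_iff)
  then show ?thesis
    by (auto simp: cycle_perms_def permutes_id)
qed

text \<open>Revealing \<open>y = p x\<close>: every cyclic permutation of \<open>X\<close> arises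
  exactly once by taking one of \<open>X - {y}\<close> and inserting \<open>y\<close> directly after
  \<open>x\<close>. Composing with the transposition on the right does this insertion.\<close>

lemma sum_cycle_perms:
  assumes "finite X" "x \<in> X" "X \<noteq> {x}"
  shows "(\<Sum>p\<in>cycle_perms X. \<phi> p) =
    (\<Sum>y\<in>X - {x}. \<Sum>p\<in>cycle_perms (X - {y}). \<phi> (p \<circ> Transposition.transpose x y))"
proof -
  \<comment> \<open>Moving a transposition across \<open>p\<close> renames its two points by
    \<open>p\<close>, so deleting \<open>p x\<close> undoes the insertion.\<close>
  have skip: "skip (p x) p = p \<circ> Transposition.transpose x (p x)" if "p permutes X" for p
    by (simp add: skip_def fun_eq_iff Transposition.transpose_def inj_eq[OF permutes_inj[OF that]])
  have to: "p x \<in> X - {x} \<and> skip (p x) p \<in> cycle_perms (X - {p x})" if p: "p \<in> cycle_perms X" for p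
  proof -
    have perm: "p permutes X" and orb: "orbit p x = X"
      using p assms(2) by (auto simp: cycle_perms_def cyclic_on_alldef)
    have "p x \<noteq> x"
      using orb assms(3) orbit_eq_singleton_iff[of p x] by auto
    moreover have "p x \<in> X"
      using perm assms(2) by (simp add: permutes_in_image)
    moreover have "orbit (skip (p x) p) x = X - {p x}"
      using orbit_skip[OF perm assms(1), of x "p x"] orb \<open>p x \<noteq> x\<close> by simp
    ultimately have "cyclic_on (skip (p x) p) (X - {p x})"
      using assms(2) by (intro cyclic_on_singleI[of x]) auto
    then show ?thesis
      using skip_permutes[OF perm] \<open>p x \<in> X\<close> \<open>p x \<noteq> x\<close> by (simp add: cycle_perms_def)
  qed
  have from_yp: "p \<circ> Transposition.transpose x y \<in> cycle_perms X" "(p \<circ> Transposition.transpose x y) x = y"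
    "skip y (p \<circ> Transposition.transpose x y) = p"
    if y: "y \<in> X - {x}" and p: "p \<in> cycle_perms (X - {y})" for y p
  proof -
    have perm: "p permutes X - {y}" and orb: "orbit p x = X - {y}"
      using p y assms(2) by (auto simp: cycle_perms_def cyclic_on_alldef)
    have py: "p y = y"
      using perm by (auto simp: permutes_def)
    let ?q = "p \<circ> Transposition.transpose x y"
    show qx: "?q x = y"
      by (simp add: py)
    have q: "?q permutes X"
      using y assms(2) permutes_subset[OF perm, of X]
      by (intro permutes_compose permutes_swap_id) auto
    show skip_q: "skip y ?q = p"
      using skip[OF q] qx by (simp add: comp_assoc)
    \<comment> \<open>Without \<open>y\<close> the cycle of \<open>x\<close> is all of
      \<open>X - {y}\<close>, and \<open>y\<close> is the image of \<open>x\<close>; hence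
      \<open>?q\<close> has a single cycle.\<close>
    then have "orbit ?q x - {y} = X - {y}"
      using orbit_skip[OF q assms(1), of x y] y orb skip_q by auto
    moreover have "y \<in> orbit ?q x"
      using orbit.base[of ?q x] qx by simp
    ultimately have "orbit ?q x = X"
      using y by blast
    then have "cyclic_on ?q X"
      using assms(2) by (intro cyclic_on_singleI[of x]) auto
    then show "?q \<in> cycle_perms X"
      using q by (simp add: cycle_perms_def)
  qed
  have "(\<Sum>p\<in>cycle_perms X. \<phi> p) =
      (\<Sum>(y, p)\<in>Sigma (X - {x}) (\<lambda>y. cycle_perms (X - {y})). \<phi> (p \<circ> Transposition.transpose x y))"
  proof (rule sum.reindex_bij_witness[where i = "\<lambda>(y, p). p \<circ> Transposition.transpose x y"
          and j = "\<lambda>p. (p x, skip (p x) p)"], goal_cases)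
    case (1 p)
    then show ?case
      using skip[of p] by (simp add: cycle_perms_def comp_assoc)
  next
    case (2 p)
    then show ?case
      using to[of p] by simp
  next
    case (3 yp)
    obtain y p where yp: "yp = (y, p)" by (cases yp)
    then have "y \<in> X - {x}" "p \<in> cycle_perms (X - {y})"
      using 3 by auto
    note fr = from_yp[OF this]
    show ?case
      unfolding yp prod.case fr(2) fr(3) ..
  next
    case (4 yp)
    obtain y p where yp: "yp = (y, p)" by (cases yp)
    then have "y \<in> X - {x}" "p \<in> cycle_perms (X - {y})"
      using 4 by auto
    note fr = from_yp[OF this]
    show ?case
      unfolding yp prod.case by (rule fr(1))
  next
    case (5 p)
    then show ?case
      using skip[of p] by (simp add: cycle_perms_def comp_assoc)
  qed
  also have "\<dots> = (\<Sum>y\<in>X - {x}. \<Sum>p\<in>cycle_perms (X - {y}). \<phi> (p \<circ> Transposition.transpose x y))"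
    using assms(1) by (intro sum.Sigma[symmetric]) (auto intro: finite_cycle_perms)
  finally show ?thesis .
qed

lemma card_cycle_perms: "finite X \<Longrightarrow> card X = Suc m \<Longrightarrow> card (cycle_perms X) = fact m"
proof (induction m arbitrary: X)
  case 0
  then show ?case
    by (auto simp: card_Suc_eq cycle_perms_singleton)
next
  case (Suc m)
  then obtain x where "x \<in> X"
    by fastforce
  moreover have "X \<noteq> {x}"
    using Suc.prems(2) by auto
  ultimately have x: "x \<in> X" "X \<noteq> {x}" by auto
  have "card (cycle_perms X) = (\<Sum>y\<in>X - {x}. card (cycle_perms (X - {y})))"
    using sum_cycle_perms[OF Suc.prems(1) x, of "\<lambda>_. 1 :: nat"] by simp
  also have "\<dots> = (\<Sum>y\<in>X - {x}. fact m)"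
    using Suc x by (intro sum.cong) auto
  finally show ?case
    using Suc.prems x by simp
qed

text \<open>
  The value at \<open>3\<close> is smaller than \<open>ln 3\<close>: with \<open>ln 3\<close> the inequality \<open>excess_step\<close> below would
  fail for \<open>m = 2\<close>.
\<close>
definition excess :: "nat \<Rightarrow> real" where
  "excess b = (if b = 2 \<or> b = 3 then 1 else ln (real b))"

section \<open>Monotonicity and the recursive inequality for \<open>excess\<close>\<close>

lemma one_le_ln_3: "1 \<le> ln (3 :: real)"
  using exp_le by (subst ln_ge_iff) auto

lemma excess_mono:
  assumes "a \<le> b"
  shows "excess a \<le> excess b"
proof -
  have "1 \<le> ln (real b)" if "b \<ge> 3"
    using one_le_ln_3 ln_mono[of 3 "real b"] that by linarith
  moreover have "ln (real a) \<le> ln (real b)"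
    using assms by (cases "a = 0"; cases "b = 0") auto
  moreover have "ln (real a) \<le> 1" if "a \<le> 1"
    using that by (cases a) auto
  ultimately show ?thesis
    using assms by (auto simp: excess_def)
qed

lemma excess_nonneg: "0 \<le> excess b"
  using excess_mono[of 0 b] by (simp add: excess_def)

text \<open>This is the average over \<open>m + 1\<close> choices of the revealed image when no
  point is fixed: the \<open>1\<close> pays for the one choice that closes a cycle, one choice
  leaves at most \<open>m\<close> moved points, and the other \<open>m\<close> choices leave at most
  \<open>m + 1\<close>.\<close>

lemma excess_step:
  "1 + excess m + real m * excess (Suc m) \<le> real (Suc m) * excess (Suc (Suc m))"
proof -
  consider "m = 0" | "m = 1" | "m = 2" | "m \<ge> 3"
    by linarith
  then show ?thesis
  proof cases
    case 3
    \<comment> \<open>Here the claim is \<open>4 \<le> 3 * ln 4 = 6 * ln 2\<close>, that is,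
      \<open>2 / 3 \<le> ln 2\<close>.\<close>
    have "ln (4 :: real) = 2 * ln 2"
      using ln_realpow[of 2 2] by simp
    with 3 show ?thesis
      using ln2_ge_two_thirds by (simp add: excess_def)
  next
    case 4
    \<comment> \<open>With \<open>k = m + 1\<close>, the gain \<open>1 / k\<close> from
      \<open>ln (k - 1) \<le> ln k - 1 / k\<close> exactly offsets the loss in
      \<open>1 - 1 / k \<le> k * ln (1 + 1 / k)\<close>.\<close>
    define k where "k = real m + 1"
    have k: "k \<ge> 4" "real m = k - 1" "real (Suc m) = k"
      using 4 by (auto simp: k_def)
    have "excess m \<le> ln (k - 1)"
      using 4 one_le_ln_3 k(2) by (auto simp: excess_def)
    also have "ln (k - 1) = ln k + ln (1 - 1 / k)"
      using k(1) ln_mult_pos[of k "1 - 1 / k"] by (simp add: right_diff_distrib)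
    also have "ln (1 - 1 / k) \<le> - (1 / k)"
      using k(1) ln_le_minus_one[of "1 - 1 / k"] by simp
    finally have 1: "excess m \<le> ln k - 1 / k"
      by simp
    have "0 < 1 + 1 / k"
      using k(1) by (simp add: add_pos_pos)
    then have "ln (k + 1) = ln k + ln (1 + 1 / k)"
      using k(1) ln_mult_pos[of k "1 + 1 / k"] by (simp add: distrib_left)
    moreover have "1 - 1 / k \<le> k * ln (1 + 1 / k)"
    proof -
      have "1 / k - (1 / k)\<^sup>2 \<le> ln (1 + 1 / k)"
        using k(1) by (intro ln_one_plus_pos_lower_bound) auto
      then have "k * (1 / k - (1 / k)\<^sup>2) \<le> k * ln (1 + 1 / k)"
        using k(1) by (intro mult_left_mono) auto
      moreover have "k * (1 / k - (1 / k)\<^sup>2) = 1 - 1 / k"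
        using k(1) by (simp add: power2_eq_square right_diff_distrib)
      ultimately show ?thesis
        by simp
    qed
    ultimately have "k * ln k + (1 - 1 / k) \<le> k * ln (k + 1)"
      by (simp add: distrib_left)
    moreover have "(k - 1) * ln k = k * ln k - ln k"
      by (simp add: left_diff_distrib)
    ultimately have "1 + excess m + (k - 1) * ln k \<le> k * ln (k + 1)"
      using 1 by linarith
    moreover have "excess (Suc m) = ln k" "excess (Suc (Suc m)) = ln (k + 1)"
      using 4 by (auto simp: excess_def k_def add_ac)
    ultimately show ?thesis
      unfolding k(2) k(3) by (simp only:)
  \<comment> \<open>For \<open>m = 0\<close> and \<open>m = 1\<close> equality holds; this is what
    forces \<open>excess\<close> to be at least 1 at 2 and at 3.\<close>
  qed (use one_le_ln_3 in \<open>auto simp: excess_def\<close>)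
qed

text \<open>Induction on the number of points: revealing the image \<open>y\<close> of one point
  \<open>x\<close> reduces the pair to a permutation \<open>\<tau> y\<close> and a random cyclic
  permutation of \<open>X - {y}\<close>. The sum is the expectation multiplied by the number of
  cyclic permutations.\<close>

lemma sum_card_orbits_cycle_perms_le:
  assumes "finite X" "X \<noteq> {}" "\<sigma> permutes X"
  shows "(\<Sum>p\<in>cycle_perms X. real (card (orbit (\<sigma> \<circ> p) ` X))) \<le>
    real (card (cycle_perms X)) * (1 + excess (card {x \<in> X. \<sigma> x \<noteq> x}))"
  using assms
proof (induction "card X" arbitrary: X \<sigma> rule: less_induct)
  case less
  let ?supp = "{x \<in> X. \<sigma> x \<noteq> x}"
  show ?case
  proof (cases "card X = 1")
    case True
    then obtain x where X: "X = {x}"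
      by (auto simp: card_1_singleton_iff)
    show ?thesis
      unfolding X cycle_perms_singleton using excess_nonneg by simp
  next
    case False
    then have "card X \<noteq> 0" "card X \<noteq> 1"
      using less.prems by auto
    then obtain m where m: "card X = Suc (Suc m)"
      by (metis One_nat_def not0_implies_Suc)
    have fin: "finite X" by (rule less.prems(1))
    \<comment> \<open>A fixed point is revealed first if there is one; otherwise
      \<open>\<sigma>\<close> moves every point, and the size of its support is known
      exactly.\<close>
    obtain x where x: "x \<in> X" and fixed: "(\<exists>z\<in>X. \<sigma> z = z) \<Longrightarrow> \<sigma> x = x"
      using less.prems(2) by blast
    have nX: "X \<noteq> {x}"
      using m by auto
    \<comment> \<open>Up to conjugation the inserted transposition stands in front of
      \<open>\<sigma>\<close>. Since \<open>p\<close> fixes \<open>y\<close>, deleting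
      \<open>y\<close> from the product only changes the fixed factor, to
      \<open>\<tau> y\<close>.\<close>
    define \<tau> where "\<tau> y = skip y (Transposition.transpose x y \<circ> \<sigma>)" for y
    define s where "s y = card {z \<in> X - {y}. \<tau> y z \<noteq> z}" for y
    define K :: real where "K = fact m"
    have perm: "Transposition.transpose x y \<circ> \<sigma> permutes X" if "y \<in> X" for y
      using less.prems(3) that x by (intro permutes_compose permutes_swap_id) auto
    have \<tau>: "\<tau> y z = (if Transposition.transpose x y (\<sigma> z) = y
        then Transposition.transpose x y (\<sigma> y) else Transposition.transpose x y (\<sigma> z))"
      if "y \<in> X" "z \<noteq> y" for y z
      using that skip_apply[OF permutes_inj[OF perm], of y y z] by (simp add: \<tau>_def)
    have \<sigma>_eq: "\<sigma> a = \<sigma> b \<longleftrightarrow> a = b" for a b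
      using permutes_inj[OF less.prems(3)] by (simp add: inj_eq)
    \<comment> \<open>The deleted point formed a cycle by itself exactly when
      \<open>\<sigma> y = x\<close>; this is the closed cycle that the extra term counts.\<close>
    have inner: "(\<Sum>p\<in>cycle_perms (X - {y}). real (card (orbit (\<sigma> \<circ> (p \<circ> Transposition.transpose x y)) ` X)))
        \<le> K * (1 + excess (s y)) + K * of_bool (\<sigma> y = x)" if y: "y \<in> X - {x}" for y
    proof -
      let ?t = "Transposition.transpose x y"
      have t: "?t permutes X"
        using x y by (intro permutes_swap_id) auto
      have card_y: "card (X - {y}) = Suc m"
        using y m by simp
      have K: "real (card (cycle_perms (X - {y}))) = K"
        using card_cycle_perms[OF _ card_y] fin by (simp add: K_def)
      have "card (orbit (\<sigma> \<circ> (p \<circ> ?t)) ` X) =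
          card (orbit (\<tau> y \<circ> p) ` (X - {y})) + of_bool (\<sigma> y = x)"
        if p: "p \<in> cycle_perms (X - {y})" for p
      proof -
        have pp: "p permutes X - {y}"
          using p by (simp add: cycle_perms_def)
        then have py: "p y = y"
          by (simp add: permutes_def)
        have q: "?t \<circ> \<sigma> \<circ> p permutes X"
          using permutes_compose[OF permutes_subset[OF pp] perm] y by auto
        have "card (orbit (\<sigma> \<circ> (p \<circ> ?t)) ` X) = card (orbit (?t \<circ> (\<sigma> \<circ> p)) ` X)"
          using card_orbits_comp_commute[OF t, of "\<sigma> \<circ> p"] by (simp add: comp_assoc)
        also have "\<dots> = card (orbit (skip y (?t \<circ> \<sigma> \<circ> p)) ` (X - {y})) + of_bool ((?t \<circ> \<sigma> \<circ> p) y = y)"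
          using card_orbits_skip[OF q fin, of y] y by (simp add: comp_assoc)
        also have "skip y (?t \<circ> \<sigma> \<circ> p) = \<tau> y \<circ> p"
          using skip_comp[where p = p and y = y, OF py] by (simp add: \<tau>_def)
        also have "(?t \<circ> \<sigma> \<circ> p) y = y \<longleftrightarrow> \<sigma> y = x"
          using py by (auto simp: Transposition.transpose_def)
        finally show ?thesis .
      qed
      then have "(\<Sum>p\<in>cycle_perms (X - {y}). real (card (orbit (\<sigma> \<circ> (p \<circ> ?t)) ` X))) =
          (\<Sum>p\<in>cycle_perms (X - {y}). real (card (orbit (\<tau> y \<circ> p) ` (X - {y}))) + of_bool (\<sigma> y = x))"
        by (intro sum.cong refl) simp
      also have "\<dots> = (\<Sum>p\<in>cycle_perms (X - {y}). real (card (orbit (\<tau> y \<circ> p) ` (X - {y}))))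
          + K * of_bool (\<sigma> y = x)"
        by (simp add: sum.distrib K)
      also have "(\<Sum>p\<in>cycle_perms (X - {y}). real (card (orbit (\<tau> y \<circ> p) ` (X - {y}))))
          \<le> real (card (cycle_perms (X - {y}))) * (1 + excess (s y))"
        unfolding s_def
      proof (rule less.hyps)
        show "card (X - {y}) < card X"
          using card_y m by simp
        show "X - {y} \<noteq> {}"
          using card_y by (metis card.empty nat.distinct(1))
        show "\<tau> y permutes X - {y}"
          unfolding \<tau>_def using perm y by (intro skip_permutes) auto
      qed (use fin in auto)
      finally show ?thesis
        by (simp add: K)
    qed
    have card_X: "real (card (cycle_perms X)) = real (Suc m) * K"
      using card_cycle_perms[OF fin m] by (simp add: K_def algebra_simps)
    have card_Xx: "card (X - {x}) = Suc m"
      using m x by simp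
    have "(\<Sum>y\<in>X - {x}. 1 + excess (s y) + of_bool (\<sigma> y = x)) \<le>
        real (Suc m) * (1 + excess (card ?supp))"
    proof (cases "\<sigma> x = x")
      case True
      have "s y \<le> card ?supp" if y: "y \<in> X - {x}" for y
      proof -
        \<comment> \<open>As \<open>\<sigma> x = x\<close>, the permutation \<open>\<tau> y\<close>
          is \<open>\<sigma>\<close> conjugated by the transposition: the fixed point is moved to
          \<open>y\<close>, and \<open>x\<close> takes over the role of \<open>y\<close>. So the
          support keeps its size.\<close>
        have "{z \<in> X - {y}. \<tau> y z \<noteq> z} \<subseteq> Transposition.transpose x y ` ?supp"
        proof
          fix z assume z: "z \<in> {z \<in> X - {y}. \<tau> y z \<noteq> z}"
          then have "\<sigma> (Transposition.transpose x y z) \<noteq> Transposition.transpose x y z"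
            using y \<tau>[of y z] True \<sigma>_eq
            by (auto simp: Transposition.transpose_def split: if_splits)
          moreover have "Transposition.transpose x y z \<in> X"
            using x y z by (auto simp: Transposition.transpose_def)
          moreover have "z = Transposition.transpose x y (Transposition.transpose x y z)"
            by simp
          ultimately show "z \<in> Transposition.transpose x y ` ?supp"
            by blast
        qed
        then have "s y \<le> card (Transposition.transpose x y ` ?supp)"
          unfolding s_def using fin by (intro card_mono) auto
        also have "\<dots> \<le> card ?supp"
          using fin by (intro card_image_le) auto
        finally show ?thesis .
      qed
      then have "1 + excess (s y) + of_bool (\<sigma> y = x) \<le> 1 + excess (card ?supp)" if "y \<in> X - {x}" for y
        using that True \<sigma>_eq[of x y] by (auto intro!: excess_mono)
      then have "(\<Sum>y\<in>X - {x}. 1 + excess (s y) + of_bool (\<sigma> y = x)) \<le>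
          (\<Sum>y\<in>X - {x}. 1 + excess (card ?supp))"
        by (rule sum_mono)
      then show ?thesis
        by (simp add: card_Xx)
    next
      case False
      then have "?supp = X"
        using fixed by blast
      have z: "\<sigma> x \<in> X - {x}"
        using False x less.prems(3) by (simp add: permutes_in_image)
      have s_le: "s y \<le> Suc m" if y: "y \<in> X - {x}" for y
      proof -
        have "s y \<le> card (X - {y})"
          unfolding s_def using fin by (intro card_mono) auto
        then show ?thesis
          using y m by simp
      qed
      have s_z: "s (\<sigma> x) \<le> m"
      proof -
        \<comment> \<open>For \<open>y = \<sigma> x\<close> the transposition sends
          \<open>\<sigma> x\<close> back to \<open>x\<close>: this is the new fixed point that
          improves the harmonic sum.\<close>
        have "\<tau> (\<sigma> x) x = x"
          using z \<tau>[of "\<sigma> x" x] by (auto simp: Transposition.transpose_def split: if_splits)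
        then have "s (\<sigma> x) \<le> card (X - {\<sigma> x} - {x})"
          unfolding s_def using fin by (intro card_mono) auto
        also have "card (X - {\<sigma> x}) = Suc m"
          using z m by simp
        then have "card (X - {\<sigma> x} - {x}) = m"
          using False x by (subst card_Diff_singleton) auto
        finally show ?thesis .
      qed
      have "(\<Sum>y\<in>X - {x}. excess (s y)) = excess (s (\<sigma> x)) + (\<Sum>y\<in>X - {x} - {\<sigma> x}. excess (s y))"
        using z fin by (simp add: sum.remove)
      also have "\<dots> \<le> excess m + (\<Sum>y\<in>X - {x} - {\<sigma> x}. excess (Suc m))"
        using s_z s_le by (intro add_mono sum_mono excess_mono) auto
      also have "\<dots> = excess m + real m * excess (Suc m)"
        using z card_Xx by simp
      finally have 1: "(\<Sum>y\<in>X - {x}. excess (s y)) \<le> excess m + real m * excess (Suc m)" .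
      have "(\<Sum>y\<in>X - {x}. of_bool (\<sigma> y = x) :: real) = real (card {y \<in> X - {x}. \<sigma> y = x})"
        using fin by (simp add: of_bool_def sum.If_cases Int_def)
      also have "card {y \<in> X - {x}. \<sigma> y = x} \<le> card {inv \<sigma> x}"
        using permutes_inverses[OF less.prems(3)] by (intro card_mono) auto
      finally have 2: "(\<Sum>y\<in>X - {x}. of_bool (\<sigma> y = x) :: real) \<le> 1"
        by simp
      show ?thesis
        using 1 2 excess_step[of m] \<open>?supp = X\<close> m card_Xx
        by (simp add: sum.distrib algebra_simps)
    qed
    then have "K * (\<Sum>y\<in>X - {x}. 1 + excess (s y) + of_bool (\<sigma> y = x)) \<le>
        K * (real (Suc m) * (1 + excess (card ?supp)))"
      by (rule mult_left_mono) (simp add: K_def)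
    moreover have "(\<Sum>p\<in>cycle_perms X. real (card (orbit (\<sigma> \<circ> p) ` X))) \<le>
        (\<Sum>y\<in>X - {x}. K * (1 + excess (s y)) + K * of_bool (\<sigma> y = x))"
      unfolding sum_cycle_perms[OF fin x nX] by (rule sum_mono) (rule inner)
    ultimately show ?thesis
      by (simp add: card_X sum_distrib_left algebra_simps)
  qed
qed

text \<open>Points outside \<open>X\<close> are deleted one at a time until \<open>D = X\<close>. A
  point of \<open>X - N\<close> shares its orbit with no other point of \<open>X\<close>, so it ends
  up fixed, and only \<open>N\<close> contributes to the support.\<close>

lemma sum_card_orbits_le:
  assumes "finite D" "\<sigma> permutes D" "X \<subseteq> D" "X \<noteq> {}" "N \<subseteq> X"
    and "\<And>x. x \<in> X - N \<Longrightarrow> orbit \<sigma> x \<inter> X \<subseteq> {x}"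
  shows "(\<Sum>p\<in>cycle_perms X. real (card (orbit (\<sigma> \<circ> p) ` D))) \<le>
    real (card (cycle_perms X)) *
      (real (card {C \<in> orbit \<sigma> ` D. C \<inter> X = {}}) + 1 + excess (card N))"
  using assms
proof (induction "card (D - X)" arbitrary: D \<sigma>)
  case 0
  then have "D = X"
    by auto
  have X: "finite X" "\<sigma> permutes X"
    using 0 \<open>D = X\<close> by auto
  have "{x \<in> X. \<sigma> x \<noteq> x} \<subseteq> N"
  proof (rule subsetI, rule ccontr)
    fix x assume x: "x \<in> {x \<in> X. \<sigma> x \<noteq> x}" "x \<notin> N"
    then have "\<sigma> x \<in> X"
      using X by (simp add: permutes_in_image)
    then show False
      using x 0(7)[of x] orbit.base[of \<sigma> x] by auto
  qed
  then have "excess (card {x \<in> X. \<sigma> x \<noteq> x}) \<le> excess (card N)"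
    using X \<open>N \<subseteq> X\<close> by (intro excess_mono card_mono) (auto intro: finite_subset)
  then have "real (card (cycle_perms X)) * (1 + excess (card {x \<in> X. \<sigma> x \<noteq> x})) \<le>
    real (card (cycle_perms X)) *
      (real (card {C \<in> orbit \<sigma> ` D. C \<inter> X = {}}) + 1 + excess (card N))"
    by (intro mult_left_mono) auto
  then show ?case
    using sum_card_orbits_cycle_perms_le[OF X(1) \<open>X \<noteq> {}\<close> X(2)] unfolding \<open>D = X\<close> by linarith
next
  case (Suc k)
  then obtain y where y: "y \<in> D" "y \<notin> X"
    by (metis DiffE card.empty equals0I nat.distinct(1))
  let ?\<sigma> = "skip y \<sigma>" and ?D = "D - {y}" and ?b = "of_bool (\<sigma> y = y) :: nat"
  note orb = orbit_skip[OF \<open>\<sigma> permutes D\<close> \<open>finite D\<close>]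
  have *: "card (orbit (\<sigma> \<circ> p) ` D) = card (orbit (?\<sigma> \<circ> p) ` ?D) + ?b" if "p \<in> cycle_perms X" for p
  proof -
    have p: "p permutes X"
      using that by (simp add: cycle_perms_def)
    then have "p y = y"
      using y by (simp add: permutes_def)
    moreover have "\<sigma> \<circ> p permutes D"
      using permutes_subset[OF p \<open>X \<subseteq> D\<close>] \<open>\<sigma> permutes D\<close> by (rule permutes_compose)
    ultimately show ?thesis
      using card_orbits_skip[of "\<sigma> \<circ> p" D y] \<open>finite D\<close> y by (simp add: skip_comp)
  qed
  \<comment> \<open>Deleting \<open>y\<close> loses an orbit only if it is \<open>{y}\<close>, and
    this orbit avoids \<open>X\<close>; thus the count on the right absorbs the same
    \<open>?b\<close> as the count on the left.\<close>
  have **: "card {C \<in> orbit ?\<sigma> ` ?D. C \<inter> X = {}} + ?b \<le> card {C \<in> orbit \<sigma> ` D. C \<inter> X = {}}"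
  proof -
    have img: "{C \<in> orbit ?\<sigma> ` ?D. C \<inter> X = {}} \<subseteq> (\<lambda>C. C - {y}) ` ({C \<in> orbit \<sigma> ` D. C \<inter> X = {}} - {{y}})"
    proof
      fix C assume "C \<in> {C \<in> orbit ?\<sigma> ` ?D. C \<inter> X = {}}"
      then obtain z where z: "z \<in> D" "z \<noteq> y" "C = orbit \<sigma> z - {y}" "C \<inter> X = {}"
        using orb by auto
      moreover have "orbit \<sigma> z \<noteq> {y}"
        using orbit_refl[OF \<open>\<sigma> permutes D\<close> \<open>finite D\<close>, of z] z by auto
      ultimately show "C \<in> (\<lambda>C. C - {y}) ` ({C \<in> orbit \<sigma> ` D. C \<inter> X = {}} - {{y}})"
        using y by blast
    qed
    have fin: "finite {C \<in> orbit \<sigma> ` D. C \<inter> X = {}}"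
      using \<open>finite D\<close> by simp
    have "card {C \<in> orbit ?\<sigma> ` ?D. C \<inter> X = {}} \<le> card ({C \<in> orbit \<sigma> ` D. C \<inter> X = {}} - {{y}})"
      using fin by (intro surj_card_le[OF _ img]) auto
    moreover have "{y} \<in> {C \<in> orbit \<sigma> ` D. C \<inter> X = {}}" if "\<sigma> y = y"
      using that y orbit_eq_singleton_iff[of \<sigma> y] by (auto intro: image_eqI[of _ _ y])
    then have "card ({C \<in> orbit \<sigma> ` D. C \<inter> X = {}} - {{y}}) + ?b \<le> card {C \<in> orbit \<sigma> ` D. C \<inter> X = {}}"
      using card_Suc_Diff1[OF fin, of "{y}"] card_Diff1_le[of "{C \<in> orbit \<sigma> ` D. C \<inter> X = {}}" "{y}"]
      by (cases "\<sigma> y = y") (simp_all del: card_Diff_insert)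
    ultimately show ?thesis
      by linarith
  qed
  have "D - X = insert y (?D - X)"
    using y by auto
  then have k: "k = card (?D - X)"
    using Suc.hyps(2) \<open>finite D\<close> by simp
  have "(\<Sum>p\<in>cycle_perms X. real (card (orbit (\<sigma> \<circ> p) ` D))) =
      (\<Sum>p\<in>cycle_perms X. real (card (orbit (?\<sigma> \<circ> p) ` ?D)) + real ?b)"
    using * by (intro sum.cong refl) simp
  also have "\<dots> = (\<Sum>p\<in>cycle_perms X. real (card (orbit (?\<sigma> \<circ> p) ` ?D))) + real (card (cycle_perms X)) * real ?b"
    by (simp add: sum.distrib)
  also have "(\<Sum>p\<in>cycle_perms X. real (card (orbit (?\<sigma> \<circ> p) ` ?D))) \<le>
      real (card (cycle_perms X)) * (real (card {C \<in> orbit ?\<sigma> ` ?D. C \<inter> X = {}}) + 1 + excess (card N))"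
  proof (rule Suc.hyps(1)[OF k])
    show "?\<sigma> permutes ?D"
      using \<open>\<sigma> permutes D\<close> y(1) by (rule skip_permutes)
    show "orbit ?\<sigma> x \<inter> X \<subseteq> {x}" if "x \<in> X - N" for x
      using Suc.prems(6)[OF that] orb[of x y] that y by auto
  qed (use Suc.prems y in auto)
  also have "real (card (cycle_perms X)) * (real (card {C \<in> orbit ?\<sigma> ` ?D. C \<inter> X = {}}) + 1 + excess (card N))
        + real (card (cycle_perms X)) * real ?b =
      real (card (cycle_perms X)) * (real (card {C \<in> orbit ?\<sigma> ` ?D. C \<inter> X = {}} + ?b) + 1 + excess (card N))"
    by (simp add: algebra_simps)
  also have "\<dots> \<le> real (card (cycle_perms X)) *
      (real (card {C \<in> orbit \<sigma> ` D. C \<inter> X = {}}) + 1 + excess (card N))"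
    using ** by (intro mult_left_mono add_right_mono of_nat_mono) auto
  finally show ?case
    by simp
qed

subsection \<open>Adding a vertex to a random embedding\<close>

lemma rtrancl_Image_eq:
  assumes "sym r" "(x, y) \<in> r\<^sup>*"
  shows "r\<^sup>* `` {x} = r\<^sup>* `` {y}"
proof -
  have "(y, x) \<in> r\<^sup>*"
    using sym_rtrancl[OF assms(1)] assms(2) by (rule symD)
  then show ?thesis
    using rtrancl_trans[OF assms(2)] rtrancl_trans[of y x r] by blast
qed

lemma expectation_Pi_pmf_insert:
  fixes h :: "('a \<Rightarrow> 'b) \<Rightarrow> real"
  assumes "finite A" "x \<notin> A" "\<And>y. y \<in> insert x A \<Longrightarrow> finite (set_pmf (p y))"
  shows "measure_pmf.expectation (Pi_pmf (insert x A) dflt p) h =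
    measure_pmf.expectation (Pi_pmf A dflt p) (\<lambda>f. measure_pmf.expectation (p x) (\<lambda>y. h (f(x := y))))"
proof -
  have "set_pmf (Pi_pmf A dflt p) \<subseteq> PiE_dflt A dflt (set_pmf \<circ> p)"
    using assms(1) by (rule set_Pi_pmf_subset')
  moreover have "finite (PiE_dflt A dflt (set_pmf \<circ> p))"
    using assms by (intro finite_PiE_dflt) auto
  ultimately have fin: "finite (set_pmf (Pi_pmf A dflt p))"
    by (rule finite_subset)
  \<comment> \<open>The new coordinate is to be drawn last, with \<open>f\<close> already fixed;
    finite supports then turn the expectations into finite sums.\<close>
  have "Pi_pmf (insert x A) dflt p = Pi_pmf A dflt p \<bind> (\<lambda>f. map_pmf (\<lambda>y. f(x := y)) (p x))"
    unfolding Pi_pmf_insert'[OF assms(1,2)] map_pmf_def by (rule bind_commute_pmf)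
  also have "measure_pmf.expectation \<dots> h = (\<Sum>f\<in>set_pmf (Pi_pmf A dflt p). pmf (Pi_pmf A dflt p) f *\<^sub>R
      measure_pmf.expectation (map_pmf (\<lambda>y. f(x := y)) (p x)) h)"
    using fin assms(3) by (intro pmf_expectation_bind) auto
  also have "\<dots> = measure_pmf.expectation (Pi_pmf A dflt p)
      (\<lambda>f. measure_pmf.expectation (p x) (\<lambda>y. h (f(x := y))))"
    using fin by (subst integral_measure_pmf[of "set_pmf (Pi_pmf A dflt p)"]) auto
  finally show ?thesis .
qed

text \<open>
  The classes of the equivalence closure of this relation are the components of the graph, as sets
  of darts, where only the vertices in \<open>A\<close> hold their darts together.
\<close>
definition dart_rel :: "'a pair_pre_digraph \<Rightarrow> 'a set \<Rightarrow> (('a \<times> 'a) \<times> ('a \<times> 'a)) set" where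
  "dart_rel G A = {(d, e). d \<in> parcs G \<and> e \<in> parcs G \<and> (e = prod.swap d \<or> fst d = fst e \<and> fst d \<in> A)}"

definition dart_classes :: "'a pair_pre_digraph \<Rightarrow> 'a set \<Rightarrow> ('a \<times> 'a) set set" where
  "dart_classes G A = (\<lambda>d. (dart_rel G A)\<^sup>* `` {d}) ` parcs G"

lemma sym_dart_rel: "sym (dart_rel G A)"
  by (auto simp: sym_def dart_rel_def)

lemma rotations_eq: "rotations G w = cycle_perms (out_arcs (with_proj G) w)"
  by (simp add: rotations_def cycle_perms_def)

context pair_graph
begin

lemma swap_in_parcs:
  assumes "d \<in> parcs G"
  shows "swap_in (parcs G) d = prod.swap d" "prod.swap d \<in> parcs G"
  using assms by (cases d; simp add: swap_in_def arcs_symmetric)+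

lemma swap_in_permutes: "swap_in (parcs G) permutes parcs G"
proof (rule bij_imp_permutes)
  show "bij_betw (swap_in (parcs G)) (parcs G) (parcs G)"
    using swap_in_parcs by (intro bij_betw_byWitness[where f' = "swap_in (parcs G)"]) auto
qed (simp add: swap_in_def)

lemma finite_out_arcs: "finite (out_arcs (with_proj G) w)"
  by (rule finite_subset[OF _ pair_finite_arcs]) (auto simp: out_arcs_def)

lemma finite_rotations: "finite (rotations G w)"
  unfolding rotations_eq by (intro finite_cycle_perms finite_out_arcs)

lemma rotations_nonempty: "rotations G w \<noteq> {}"
proof (cases "out_arcs (with_proj G) w = {}")
  case True
  then show ?thesis
    by (auto simp: rotations_eq cycle_perms_def intro: exI[of _ id] permutes_id)
next
  case False
  with False show ?thesis
    using finite_out_arcs[of w] card_cycle_perms[of "out_arcs (with_proj G) w" "card (out_arcs (with_proj G) w) - 1"]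
    by (auto simp: rotations_eq card_gt_0_iff)
qed

section \<open>The face permutation of a partial embedding with rotations on \<open>A\<close>
  only\<close>

context
  fixes A :: "'a set" and \<pi> :: "'a \<Rightarrow> 'a \<times> 'a \<Rightarrow> 'a \<times> 'a"
  assumes rot: "\<And>w. w \<in> A \<Longrightarrow> \<pi> w \<in> rotations G w" and dflt: "\<And>w. w \<notin> A \<Longrightarrow> \<pi> w = id"
begin

lemma rotation_permutes: "\<pi> w permutes out_arcs (with_proj G) w"
  using rot[of w] dflt[of w] by (cases "w \<in> A") (auto simp: rotations_def permutes_id)

lemma rotation_in:
  assumes "d \<in> parcs G"
  shows "\<pi> (fst d) d \<in> parcs G" "fst (\<pi> (fst d) d) = fst d"
  using permutes_in_image[OF rotation_permutes[of "fst d"], of d] assms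
  by (auto simp: out_arcs_def)

lemma face_perm_permutes: "face_perm G \<pi> permutes parcs G"
proof -
  let ?p = "\<lambda>d. \<pi> (fst d) d"
  have "inj_on ?p (parcs G)"
  proof (rule inj_onI)
    fix d e assume de: "d \<in> parcs G" "e \<in> parcs G" "?p d = ?p e"
    then have "fst d = fst e"
      using rotation_in(2) by metis
    then show "d = e"
      using de(3) permutes_inj[OF rotation_permutes] by (metis injD)
  qed
  moreover have "?p ` parcs G \<subseteq> parcs G"
    using rotation_in(1) by blast
  ultimately have "bij_betw ?p (parcs G) (parcs G)"
    using endo_inj_surj[OF pair_finite_arcs] by (simp add: bij_betw_def)
  moreover have "?p d = d" if "d \<notin> parcs G" for d
    using permutes_not_in[OF rotation_permutes[of "fst d"], of d] that by (simp add: out_arcs_def)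
  ultimately have "?p permutes parcs G"
    by (rule bij_imp_permutes)
  then show ?thesis
    unfolding face_perm_def using swap_in_permutes by (rule permutes_compose)
qed

lemma face_perm_dart_rel:
  assumes "d \<in> parcs G"
  shows "(d, face_perm G \<pi> d) \<in> (dart_rel G A)\<^sup>*"
proof -
  let ?e = "\<pi> (fst d) d"
  have "(d, ?e) \<in> (dart_rel G A)\<^sup>*"
  proof (cases "fst d \<in> A")
    case True
    then show ?thesis
      using rotation_in[OF assms] assms by (auto simp: dart_rel_def intro!: r_into_rtrancl)
  next
    case False
    then show ?thesis
      by (simp add: dflt)
  qed
  moreover have "(?e, face_perm G \<pi> d) \<in> dart_rel G A"
    using rotation_in(1)[OF assms] swap_in_parcs by (simp add: face_perm_def dart_rel_def)
  ultimately show ?thesis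
    by (rule rtrancl_into_rtrancl)
qed

lemma orbit_face_perm_subset:
  assumes "d \<in> parcs G"
  shows "orbit (face_perm G \<pi>) d \<subseteq> (dart_rel G A)\<^sup>* `` {d}"
proof
  fix e assume "e \<in> orbit (face_perm G \<pi>) d"
  then have "(d, e) \<in> (dart_rel G A)\<^sup>* \<and> e \<in> parcs G"
  proof induction
    case base
    then show ?case
      using face_perm_dart_rel[OF assms] assms face_perm_permutes by (simp add: permutes_in_image)
  next
    case (step e)
    then show ?case
      using face_perm_dart_rel[of e] face_perm_permutes rtrancl_trans[of d e]
      by (simp add: permutes_in_image)
  qed
  then show "e \<in> (dart_rel G A)\<^sup>* `` {d}"
    by simp
qed

text \<open>A face stays inside one component, so distinct components meeting \<open>X\<close>
  contain distinct faces meeting \<open>X\<close>. For \<open>X\<close> the darts at the next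
  vertex, this bounds from below the number of faces given up there.\<close>

lemma card_dart_classes_meeting_le:
  assumes "X \<subseteq> parcs G"
  shows "card {C \<in> orbit (face_perm G \<pi>) ` parcs G. C \<inter> X = {}} + card {C \<in> dart_classes G A. C \<inter> X \<noteq> {}}
    \<le> card (faces G \<pi>)"
proof -
  let ?O = "orbit (face_perm G \<pi>) ` parcs G" and ?r = "(dart_rel G A)\<^sup>*"
  have fin: "finite ?O"
    using pair_finite_arcs by simp
  have "{C \<in> dart_classes G A. C \<inter> X \<noteq> {}} \<subseteq> (\<lambda>C. ?r `` C) ` {C \<in> ?O. C \<inter> X \<noteq> {}}"
  proof
    fix C assume "C \<in> {C \<in> dart_classes G A. C \<inter> X \<noteq> {}}"
    then obtain d x where x: "C = ?r `` {d}" "(d, x) \<in> ?r" "x \<in> X"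
      by (auto simp: dart_classes_def)
    then have C: "C = ?r `` {x}" and xD: "x \<in> parcs G"
      using rtrancl_Image_eq[OF sym_dart_rel x(2)] assms by auto
    have self: "x \<in> orbit (face_perm G \<pi>) x"
      using orbit_refl[OF face_perm_permutes pair_finite_arcs] .
    have "?r `` orbit (face_perm G \<pi>) x = ?r `` {x}"
      using orbit_face_perm_subset[OF xD] self rtrancl_trans[of x _ "dart_rel G A"] by blast
    then show "C \<in> (\<lambda>C. ?r `` C) ` {C \<in> ?O. C \<inter> X \<noteq> {}}"
      using C xD self x(3) by (intro image_eqI[of _ _ "orbit (face_perm G \<pi>) x"]) auto
  qed
  then have "card {C \<in> dart_classes G A. C \<inter> X \<noteq> {}} \<le> card {C \<in> ?O. C \<inter> X \<noteq> {}}"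
    using fin by (intro surj_card_le) auto
  moreover have "card ?O = card {C \<in> ?O. C \<inter> X = {}} + card {C \<in> ?O. C \<inter> X \<noteq> {}}"
    using fin by (subst card_Un_disjoint[symmetric]) (auto intro!: arg_cong[where f = card])
  ultimately show ?thesis
    by (simp add: faces_def)
qed

text \<open>The rotation at \<open>v\<close> was the identity before, so installing \<open>p\<close>
  is composition on the right, the shape treated by \<open>sum_card_orbits_le\<close>.\<close>

lemma face_perm_update:
  assumes "v \<notin> A" "p permutes out_arcs (with_proj G) v"
  shows "face_perm G (\<pi>(v := p)) = face_perm G \<pi> \<circ> p"
proof
  fix d
  show "face_perm G (\<pi>(v := p)) d = (face_perm G \<pi> \<circ> p) d"
  proof (cases "d \<in> out_arcs (with_proj G) v")
    case True
    then have "fst d = v" "fst (p d) = v"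
      using permutes_in_image[OF assms(2), of d] by (auto simp: out_arcs_def)
    then show ?thesis
      using dflt[OF assms(1)] by (simp add: face_perm_def)
  next
    case False
    then have "p d = d"
      by (rule permutes_not_in[OF assms(2)])
    then show ?thesis
      using dflt[OF assms(1)] by (auto simp: face_perm_def)
  qed
qed

text \<open>Where neither end has a rotation yet, the face permutation merely reverses the dart back
  and forth.\<close>

lemma orbit_face_perm_pendant:
  assumes "d \<in> parcs G" "fst d \<notin> A" "snd d \<notin> A"
  shows "orbit (face_perm G \<pi>) d \<subseteq> {d, prod.swap d}"
proof
  have *: "face_perm G \<pi> d = prod.swap d" "face_perm G \<pi> (prod.swap d) = d"
    using assms swap_in_parcs[OF assms(1)] swap_in_parcs(1)[OF swap_in_parcs(2)[OF assms(1)]]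
    by (simp_all add: face_perm_def dflt)
  fix e assume "e \<in> orbit (face_perm G \<pi>) d"
  then show "e \<in> {d, prod.swap d}"
  proof induction
    case base
    show ?case
      by (simp only: * insert_iff simp_thms)
  next
    case (step e)
    then have "e = d \<or> e = prod.swap d"
      by blast
    then show ?case
      by (elim disjE) (simp_all only: * insert_iff simp_thms)
  qed
qed

end

text \<open>Holding the darts at \<open>v\<close> together can only merge the classes that meet
  them; the other classes persist, and the class of a dart at \<open>v\<close> is one more.\<close>

lemma card_dart_classes_insert:
  assumes "out_arcs (with_proj G) v \<noteq> {}"
  shows "card (dart_classes G A) + 1 \<le>
    card (dart_classes G (insert v A)) + card {C \<in> dart_classes G A. C \<inter> out_arcs (with_proj G) v \<noteq> {}}"
proof -
  let ?X = "out_arcs (with_proj G) v"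
  let ?r = "dart_rel G A" and ?s = "dart_rel G (insert v A)"
  obtain x where x: "x \<in> ?X"
    using assms by blast
  have fin: "finite (dart_classes G B)" for B
    using pair_finite_arcs by (simp add: dart_classes_def)
  have "{C \<in> dart_classes G A. C \<inter> ?X = {}} \<subseteq> dart_classes G (insert v A) - {?s\<^sup>* `` {x}}"
  proof
    fix C assume "C \<in> {C \<in> dart_classes G A. C \<inter> ?X = {}}"
    then obtain d where d: "d \<in> parcs G" "C = ?r\<^sup>* `` {d}" "C \<inter> ?X = {}"
      by (auto simp: dart_classes_def)
    have "?r \<subseteq> ?s"
      by (auto simp: dart_rel_def)
    then have "C \<subseteq> ?s\<^sup>* `` {d}"
      using rtrancl_mono[of ?r ?s] d(2) by blast
    moreover have "e \<in> C" if "(d, e) \<in> ?s\<^sup>*" for e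
      using that
    proof induction
      case base
      show ?case
        using d(2) by simp
    next
      case (step e f)
      then have "e \<notin> ?X"
        using d(3) by blast
      then have "(e, f) \<in> ?r"
        using step.hyps(2) by (auto simp: dart_rel_def out_arcs_def)
      then show ?case
        using step.IH d(2) by (auto intro: rtrancl_into_rtrancl)
    qed
    ultimately have "C = ?s\<^sup>* `` {d}"
      by blast
    moreover have "C \<noteq> ?s\<^sup>* `` {x}"
      using x d(3) by blast
    ultimately show "C \<in> dart_classes G (insert v A) - {?s\<^sup>* `` {x}}"
      using d(1) by (auto simp: dart_classes_def)
  qed
  then have "card {C \<in> dart_classes G A. C \<inter> ?X = {}} \<le> card (dart_classes G (insert v A) - {?s\<^sup>* `` {x}})"
    using fin by (intro card_mono) auto
  also have "\<dots> < card (dart_classes G (insert v A))"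
    using fin x by (intro card_Diff1_less) (auto simp: dart_classes_def out_arcs_def)
  finally have "card {C \<in> dart_classes G A. C \<inter> ?X = {}} + 1 \<le> card (dart_classes G (insert v A))"
    by simp
  moreover have "card (dart_classes G A) =
      card {C \<in> dart_classes G A. C \<inter> ?X = {}} + card {C \<in> dart_classes G A. C \<inter> ?X \<noteq> {}}"
    using fin by (subst card_Un_disjoint[symmetric]) (auto intro!: arg_cong[where f = card])
  ultimately show ?thesis
    by simp
qed

text \<open>Faces avoiding \<open>v\<close> survive, and the others are replaced by at most
  \<open>1 + excess\<close> in expectation. At least one old face per component at \<open>v\<close>
  is lost, and the \<open>1\<close> is compensated by the single component that these merge
  into.\<close>

lemma expectation_faces_update_le:
  assumes "\<And>w. w \<in> A \<Longrightarrow> \<pi> w \<in> rotations G w" "\<And>w. w \<notin> A \<Longrightarrow> \<pi> w = id" "v \<notin> A" "finite A"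
  shows "measure_pmf.expectation (pmf_of_set (rotations G v)) (\<lambda>p. real (card (faces G (\<pi>(v := p)))))
    \<le> real (card (faces G \<pi>)) + (real (card (dart_classes G (insert v A))) - real (card (dart_classes G A))
        + excess (card {w \<in> A. (v, w) \<in> parcs G}))"
proof -
  let ?X = "out_arcs (with_proj G) v" and ?F = "face_perm G \<pi>"
  \<comment> \<open>These are the darts leading back to processed vertices; only they can share an
    old face with another dart at \<open>v\<close>.\<close>
  let ?N = "{d \<in> ?X. snd d \<in> A}"
  note upd = face_perm_update[where A = A and \<pi> = \<pi>, OF assms(1,2) assms(3)]
  have E: "measure_pmf.expectation (pmf_of_set (rotations G v)) (\<lambda>p. real (card (faces G (\<pi>(v := p))))) =
      (\<Sum>p\<in>rotations G v. real (card (orbit (?F \<circ> p) ` parcs G))) / real (card (rotations G v))"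
  proof -
    have "(\<Sum>p\<in>rotations G v. real (card (faces G (\<pi>(v := p))))) =
        (\<Sum>p\<in>rotations G v. real (card (orbit (?F \<circ> p) ` parcs G)))"
      using upd by (intro sum.cong refl) (simp add: faces_def rotations_def)
    then show ?thesis
      using rotations_nonempty finite_rotations by (simp add: integral_pmf_of_set)
  qed
  show ?thesis
  proof (cases "?X = {}")
    case True
    have "rotations G v = {id}"
      by (auto simp: True rotations_def permutes_id)
    moreover have "dart_rel G (insert v A) = dart_rel G A"
      using True by (auto simp: dart_rel_def out_arcs_def)
    ultimately show ?thesis
      unfolding E using excess_nonneg by (simp add: faces_def dart_classes_def)
  next
    case False
    have X: "?X \<subseteq> parcs G"
      by (auto simp: out_arcs_def)
    have N: "card ?N = card {w \<in> A. (v, w) \<in> parcs G}"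
      by (rule bij_betw_same_card[of snd], rule bij_betw_byWitness[where f' = "\<lambda>w. (v, w)"])
         (auto simp: out_arcs_def)
    have perm: "?F permutes parcs G"
      using face_perm_permutes[where A = A] assms(1,2) by blast
    have iso: "orbit ?F x \<inter> ?X \<subseteq> {x}" if x: "x \<in> ?X - ?N" for x
    proof -
      have "orbit ?F x \<subseteq> {x, prod.swap x}"
        using x assms by (intro orbit_face_perm_pendant[where A = A]) (auto simp: out_arcs_def)
      \<comment> \<open>The reverse dart starts at the other end of the edge, which differs from
        \<open>v\<close> because there are no loops.\<close>
      moreover have "prod.swap x \<notin> ?X"
        using x no_loops[of x] by (auto simp: out_arcs_def)
      ultimately show ?thesis
        by blast
    qed
    have "(\<Sum>p\<in>rotations G v. real (card (orbit (?F \<circ> p) ` parcs G))) \<le>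
        real (card (rotations G v)) *
          (real (card {C \<in> orbit ?F ` parcs G. C \<inter> ?X = {}}) + 1 + excess (card ?N))"
      unfolding rotations_eq
      by (rule sum_card_orbits_le[OF pair_finite_arcs perm X False _ iso]) auto
    moreover have "real (card (rotations G v)) > 0"
      using rotations_nonempty finite_rotations by (simp add: card_gt_0_iff)
    ultimately have "(\<Sum>p\<in>rotations G v. real (card (orbit (?F \<circ> p) ` parcs G))) / real (card (rotations G v))
        \<le> real (card {C \<in> orbit ?F ` parcs G. C \<inter> ?X = {}}) + 1 + excess (card ?N)"
      by (simp add: pos_divide_le_eq mult.commute)
    moreover have "card {C \<in> orbit ?F ` parcs G. C \<inter> ?X = {}} + card {C \<in> dart_classes G A. C \<inter> ?X \<noteq> {}}
        \<le> card (faces G \<pi>)"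
      using card_dart_classes_meeting_le[where A = A, OF _ _ X] assms(1,2) by blast
    ultimately show ?thesis
      using card_dart_classes_insert[OF False, of A] unfolding E N by linarith
  qed
qed

text \<open>The increment in \<open>expectation_faces_update_le\<close> does not depend on the
  rotations chosen so far, so it passes through the outer expectation.\<close>

lemma expectation_faces_insert_le:
  assumes "finite A" "v \<notin> A"
  shows "measure_pmf.expectation (Pi_pmf (insert v A) id (\<lambda>w. pmf_of_set (rotations G w))) (\<lambda>\<pi>. real (card (faces G \<pi>)))
    \<le> measure_pmf.expectation (Pi_pmf A id (\<lambda>w. pmf_of_set (rotations G w))) (\<lambda>\<pi>. real (card (faces G \<pi>)))
      + (real (card (dart_classes G (insert v A))) - real (card (dart_classes G A))
        + excess (card {w \<in> A. (v, w) \<in> parcs G}))"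
    (is "_ \<le> measure_pmf.expectation ?P ?F + ?c")
proof -
  have set_pmf: "set_pmf (pmf_of_set (rotations G w)) = rotations G w" for w
    using rotations_nonempty finite_rotations by simp
  have set: "\<pi> \<in> PiE_dflt A id (rotations G)" if "\<pi> \<in> set_pmf ?P" for \<pi>
    using set_Pi_pmf_subset'[OF assms(1)] that set_pmf by (fastforce simp: PiE_dflt_def)
  have "finite (PiE_dflt A id (rotations G))"
    using assms(1) finite_rotations by (intro finite_PiE_dflt) auto
  then have int: "integrable (measure_pmf ?P) h" for h :: "_ \<Rightarrow> real"
    using set by (intro integrable_measure_pmf_finite) (auto intro: finite_subset)
  have "measure_pmf.expectation (Pi_pmf (insert v A) id (\<lambda>w. pmf_of_set (rotations G w))) ?F =
      measure_pmf.expectation ?P (\<lambda>\<pi>. measure_pmf.expectation (pmf_of_set (rotations G v)) (\<lambda>p. ?F (\<pi>(v := p))))"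
    using assms by (intro expectation_Pi_pmf_insert) (auto simp: set_pmf finite_rotations)
  also have "\<dots> \<le> measure_pmf.expectation ?P (\<lambda>\<pi>. ?F \<pi> + ?c)"
  proof (intro integral_mono_AE int AE_pmfI)
    fix \<pi> assume "\<pi> \<in> set_pmf ?P"
    then have "\<pi> \<in> PiE_dflt A id (rotations G)"
      by (rule set)
    then show "measure_pmf.expectation (pmf_of_set (rotations G v)) (\<lambda>p. ?F (\<pi>(v := p))) \<le> ?F \<pi> + ?c"
      using assms by (intro expectation_faces_update_le) (auto simp: PiE_dflt_def)
  qed
  also have "\<dots> = measure_pmf.expectation ?P ?F + ?c"
    using int by simp
  finally show ?thesis .
qed

lemma faces_id: "faces G (\<lambda>_. id) = dart_classes G {}"
proof -
  have fp: "face_perm G (\<lambda>_. id) d = prod.swap d" if "d \<in> parcs G" for d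
    using swap_in_parcs[OF that] by (simp add: face_perm_def)
  have perm: "face_perm G (\<lambda>_. id) permutes parcs G"
    by (rule face_perm_permutes[of "{}"]) auto
  have "orbit (face_perm G (\<lambda>_. id)) d = (dart_rel G {})\<^sup>* `` {d}" if d: "d \<in> parcs G" for d
  proof
    show "orbit (face_perm G (\<lambda>_. id)) d \<subseteq> (dart_rel G {})\<^sup>* `` {d}"
      using d by (intro orbit_face_perm_subset) auto
    have "e \<in> orbit (face_perm G (\<lambda>_. id)) d" if "(d, e) \<in> (dart_rel G {})\<^sup>*" for e
      using that
    proof induction
      case base
      show ?case
        by (rule orbit_refl[OF perm pair_finite_arcs])
    next
      case (step e f)
      then have "f = face_perm G (\<lambda>_. id) e"
        using fp by (auto simp: dart_rel_def)
      then show ?case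
        using orbit.step[OF step.IH] by (simp only:)
    qed
    then show "(dart_rel G {})\<^sup>* `` {d} \<subseteq> orbit (face_perm G (\<lambda>_. id)) d"
      by auto
  qed
  then show ?thesis
    by (simp add: faces_def dart_classes_def)
qed

text \<open>Expected faces minus components is the quantity that telescopes along the vertex
  order.\<close>

lemma expectation_faces_le:
  fixes v :: "nat \<Rightarrow> 'a"
  assumes "inj_on v {1..j}"
  shows "measure_pmf.expectation (Pi_pmf (v ` {1..j}) id (\<lambda>w. pmf_of_set (rotations G w))) (\<lambda>\<pi>. real (card (faces G \<pi>)))
    \<le> real (card (dart_classes G (v ` {1..j}))) + (\<Sum>i = 1..j. excess (card {w \<in> v ` {1..<i}. (v i, w) \<in> parcs G}))"
  using assms
proof (induction j)
  case 0
  then show ?case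
    by (simp add: faces_id[unfolded id_def])
next
  case (Suc j)
  let ?E = "\<lambda>B. measure_pmf.expectation (Pi_pmf B id (\<lambda>w. pmf_of_set (rotations G w))) (\<lambda>\<pi>. real (card (faces G \<pi>)))"
  let ?e = "\<lambda>i. excess (card {w \<in> v ` {1..<i}. (v i, w) \<in> parcs G})"
  have "inj_on v {1..j}"
    using Suc.prems by (rule inj_on_subset) auto
  then have "?E (v ` {1..j}) \<le> real (card (dart_classes G (v ` {1..j}))) + (\<Sum>i = 1..j. ?e i)"
    by (rule Suc.IH)
  moreover have "v (Suc j) \<notin> v ` {1..j}"
    using Suc.prems by (auto dest: inj_onD)
  then have "?E (insert (v (Suc j)) (v ` {1..j})) \<le> ?E (v ` {1..j}) +
      (real (card (dart_classes G (insert (v (Suc j)) (v ` {1..j})))) - real (card (dart_classes G (v ` {1..j})))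
        + ?e (Suc j))"
    unfolding atLeastLessThanSuc_atLeastAtMost by (intro expectation_faces_insert_le) auto
  moreover have "(\<Sum>i = 1..Suc j. ?e i) = (\<Sum>i = 1..j. ?e i) + ?e (Suc j)"
    by simp
  moreover have "v ` {1..Suc j} = insert (v (Suc j)) (v ` {1..j})"
    by (simp add: atLeastAtMostSuc_conv)
  ultimately show ?case
    by (simp only:)
qed

text \<open>A path in the graph links the darts at its two ends. The bound is an inequality because
  a single vertex without darts has no class.\<close>

lemma card_dart_classes_connected:
  assumes "Digraph_Component.connected (with_proj G)"
  shows "card (dart_classes G (pverts G)) \<le> 1"
proof -
  let ?r = "(dart_rel G (pverts G))\<^sup>*"
  have same_tail: "(d, e) \<in> ?r" if "d \<in> parcs G" "e \<in> parcs G" "fst d = fst e" for d e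
    using that arc_fst_in_verts by (auto simp: dart_rel_def intro!: r_into_rtrancl)
  have "(d, e) \<in> ?r" if d: "d \<in> parcs G" and e: "e \<in> parcs G" for d e
  proof -
    have "fst d \<rightarrow>\<^sup>*\<^bsub>with_proj (mk_symmetric (with_proj G))\<^esub> fst e"
      using assms d e arc_fst_in_verts by (auto simp: connected_def strongly_connected_def)
    then have "(fst d, fst e) \<in> (parcs G)\<^sup>*"
      using rtrancl_on_rtranclI adj_mk_symmetric_eq[OF sym_arcs] by (auto simp: reachable_def)
    \<comment> \<open>The claim carried along the path concerns all darts at the current vertex, so
      that the dart to the next vertex is among them.\<close>
    then have "\<forall>e'\<in>parcs G. fst e' = fst e \<longrightarrow> (d, e') \<in> ?r"
    proof induction
      case base
      then show ?case
        using same_tail d by simp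
    next
      case (step u w)
      have "(d, (u, w)) \<in> ?r"
        using step.IH step.hyps(2) by simp
      moreover have "((u, w), (w, u)) \<in> dart_rel G (pverts G)"
        using step.hyps(2) arcs_symmetric by (auto simp: dart_rel_def)
      ultimately have wu: "(d, (w, u)) \<in> ?r"
        by (rule rtrancl_into_rtrancl)
      have "(w, u) \<in> parcs G"
        using step.hyps(2) by (rule arcs_symmetric)
      then have "((w, u), e') \<in> ?r" if "e' \<in> parcs G" "fst e' = w" for e'
        using same_tail that by simp
      then show ?case
        using rtrancl_trans[OF wu] by blast
    qed
    then show ?thesis
      using e by blast
  qed
  then have eq: "?r `` {d} = ?r `` {e}" if "d \<in> parcs G" "e \<in> parcs G" for d e
    using that by (intro rtrancl_Image_eq sym_dart_rel)
  show ?thesis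
  proof (cases "parcs G = {}")
    case False
    then obtain d where d: "d \<in> parcs G"
      by blast
    have "dart_classes G (pverts G) \<subseteq> {?r `` {d}}"
      unfolding dart_classes_def
      by (rule image_subsetI) (rule singleton_iff[THEN iffD2, OF eq[OF _ d]])
    then show ?thesis
      using card_mono[of "{?r `` {d}}"] by simp
  qed (simp add: dart_classes_def)
qed

end

section \<open>From \<open>excess\<close> to the two back-degree bounds\<close>

lemma excess_le_ln_adjusted_back_degree:
  "excess (card {w \<in> v ` {1..<i}. (v i, w) \<in> parcs G}) \<le> ln (adjusted_back_degree G v i)"
proof -
  define k where "k = card {w \<in> v ` {1..<i}. (v i, w) \<in> parcs G}"
  have "back_degree G v i = (if k = 0 then 1 else k)"
    by (simp only: back_degree_def Let_def k_def)
  \<comment> \<open>With no back-neighbor both sides are 0, as \<open>ln 0 = 0\<close> and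
    \<open>ln 1 = 0\<close>; for two both are 1; for three the claim is \<open>1 \<le> ln 3\<close>;
    otherwise they agree.\<close>
  then show ?thesis
    using one_le_ln_3 unfolding k_def[symmetric] by (auto simp: excess_def adjusted_back_degree_def)
qed

text \<open>At back-degree 2 both sides are 1, and elsewhere this is the usual bound
  \<open>ln (m + 1) \<le> harm m\<close>.\<close>

lemma ln_adjusted_back_degree_le_harm:
  "ln (adjusted_back_degree G v i) \<le> harm (back_degree G v i - 1)"
proof (cases "back_degree G v i = 2")
  case True
  then show ?thesis
    by (simp add: adjusted_back_degree_def harm_expand)
next
  case False
  have "1 \<le> (if k = 0 then 1 else k)" for k :: nat
    by simp
  then have "1 \<le> back_degree G v i"
    unfolding back_degree_def Let_def .
  then show ?thesis
    using False ln_le_harm[of "back_degree G v i - 1"] by (simp add: adjusted_back_degree_def of_nat_diff)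
qed

theorem theorem8:
  fixes G :: "'a pair_pre_digraph" and v :: "nat \<Rightarrow> 'a" and n :: nat
  assumes "pair_graph G"
    and "Digraph_Component.connected (with_proj G)"
    and "card (pverts G) = n"
    and "bij_betw v {1..n} (pverts G)"
  shows "expected_faces G \<le> 1 + (\<Sum>i = 3..n. ln (adjusted_back_degree G v i)) \<and>
         expected_faces G \<le> 1 + (\<Sum>i = 3..n. harm (back_degree G v i - 1))"
proof -
  interpret pair_graph G by fact
  let ?b = "\<lambda>i. card {w \<in> v ` {1..<i}. (v i, w) \<in> parcs G}"
  have v: "inj_on v {1..n}" "v ` {1..n} = pverts G"
    using assms(4) by (auto simp: bij_betw_def)
  \<comment> \<open>The first two vertices have at most one back-neighbor, where
    \<open>excess\<close> vanishes; hence the sums may start at 3.\<close>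
  have "excess (?b i) = 0" if "i \<in> {1..n} - {3..n}" for i
  proof -
    have "i = 1 \<or> i = 2"
      using that by auto
    then have "{1..<i} \<subseteq> {1}"
      by auto
    then have b: "?b i \<le> card {v 1}"
      by (intro card_mono) auto
    have "excess k = 0" if "k \<le> card {v 1}" for k
      using that by (cases k) (auto simp: excess_def)
    from this[OF b] show ?thesis .
  qed
  then have "(\<Sum>i = 1..n. excess (?b i)) = (\<Sum>i = 3..n. excess (?b i))"
    by (intro sum.mono_neutral_right) auto
  also have "\<dots> \<le> (\<Sum>i = 3..n. ln (adjusted_back_degree G v i))"
    by (intro sum_mono excess_le_ln_adjusted_back_degree)
  finally have "expected_faces G \<le> 1 + (\<Sum>i = 3..n. ln (adjusted_back_degree G v i))"
    using expectation_faces_le[OF v(1)] card_dart_classes_connected[OF assms(2)]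
    unfolding v(2) expected_faces_def random_embedding_def by linarith
  moreover have "(\<Sum>i = 3..n. ln (adjusted_back_degree G v i)) \<le> (\<Sum>i = 3..n. harm (back_degree G v i - 1))"
    by (intro sum_mono ln_adjusted_back_degree_le_harm)
  ultimately show ?thesis
    by simp
qed

end
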